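(* Let $\mathfrak{L}_\pm$ be dual definite subspaces of the Krein space $(\mathfrak{H},[\cdot,\cdot])$ whose algebraic sum $\mathfrak{L}_++\mathfrak{L}_-$ is dense in $\mathfrak{H}$, and let $G_0$ be the corresponding positive symmetric operator. Then $\mathfrak{L}_\pm$ are quasi maximal if and only if there exists an extremal extension $G$ of $G_0$ which satisfies $JGf=G^{-1}Jf$ for all $f\in D(G)$.
   Context: $\mathfrak{H}$ is a complex Hilbert space with inner product $(\cdot,\cdot)$ (linear in the first argument), $J$ is a bounded operator with $J=J^*$, $J^2=I$, $J\neq\pm I$, and $[f,g]=(Jf,g)$. Put $P_\pm=\frac12(I\pm J)$, $\mathfrak{H}_\pm=P_\pm\mathfrak{H}$. Subspaces are closed. Dual definite subspaces $\mathfrak{L}_\pm$: $[f,f]>0$ for $0\ne f\in\mathfrak{L}_+$, $[f,f]<0$ for $0\neq f\in\mathfrak{L}_-$, and $[f_+,f_-]=0$ for all $f_\pm\in\mathfrak{L}_\pm$. Associated operators: $\mathfrak{L}_\pm$ can be written uniquely as $\mathfrak{L}_+=\{x_++K_+^-x_+:x_+\in M_+\}$, $\mathfrak{L}_-=\{x_-+K_-^+x_-:x_-\in M_-\}$ with $M_\pm$ closed subspaces of $\mathfrak{H}_\pm$ and $K_+^-:M_+\to\mathfrak{H}_-$, $K_-^+:M_-\to\mathfrak{H}_+$ strong contractions ($\|Kf\|<\|f\|$ for $f\neq0$). Put $T_0=K_+^-P_++K_-^+P_-$, $D(T_0)=M_+\oplus M_-$, and $G_0=(I-T_0)(I+T_0)^{-1}$.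 Then $D(G_0)=\mathfrak{L}_++\mathfrak{L}_-$, equivalently $G_0(f_++f_-)=J(f_+-f_-)$ for $f_\pm\in\mathfrak{L}_\pm$, and $G_0$ is a closed densely defined positive symmetric operator. "Positive" for an operator $G$ means $(Gf,f)>0$ for all $0\ne f\in D(G)$; every nonnegative self-adjoint extension of $G_0$ is positive. For a positive self-adjoint extension $G\supset G_0$, $(\mathfrak{H}_G,(\cdot,\cdot)_G)$ denotes the completion of $D(G)$ with respect to the inner product $(f,g)_G=(Gf,g)$. The subspaces $\mathfrak{L}_\pm$ are called quasi maximal if there exists a positive self-adjoint extension $G\supset G_0$ with $JGf=G^{-1}Jf$ for all $f\in D(G)$ (in particular $Jf\in D(G^{-1})$) and such that $D(G_0)$ is dense in $(\mathfrak{H}_G,(\cdot,\cdot)_G)$. A nonnegative self-adjoint extension $G$ of $G_0$ is called extremal if $\inf_{f\in D(G_0)}(G(\phi-f),\phi-f)=0$ for all $\phi\in D(G)$. *)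

theory Defs
  imports "HOL-Analysis.Analysis" "HOL-Library.Complex_Order"
begin

section \<open>Complex Hilbert spaces\<close>

class complex_hilbert = banach +
  fixes scaleC :: "complex \<Rightarrow> 'a \<Rightarrow> 'a" (infixr "*\<^sub>C" 75)
    and cinner :: "'a \<Rightarrow> 'a \<Rightarrow> complex"
  assumes scaleC_add_right: "c *\<^sub>C (x + y) = c *\<^sub>C x + c *\<^sub>C y"
    and scaleC_add_left: "(c + d) *\<^sub>C x = c *\<^sub>C x + d *\<^sub>C x"
    and scaleC_scaleC: "c *\<^sub>C d *\<^sub>C x = (c * d) *\<^sub>C x"
    and scaleC_of_real: "complex_of_real r *\<^sub>C x = r *\<^sub>R x"
    and cinner_add_left: "cinner (x + y) z = cinner x z + cinner y z"
    and cinner_scaleC_left: "cinner (c *\<^sub>C x) y = c * cinner x y"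
    and cinner_commute: "cinner x y = cnj (cinner y x)"
    and cinner_self: "cinner x x = complex_of_real ((norm x)\<^sup>2)"

instantiation complex :: complex_hilbert
begin

definition "scaleC_complex (c::complex) (x::complex) = c * x"
definition "cinner_complex (x::complex) (y::complex) = x * cnj y"

instance
  by standard
    (auto simp: scaleC_complex_def cinner_complex_def algebra_simps scaleR_conv_of_real
      complex_norm_square[symmetric])

end

instantiation prod :: (complex_hilbert, complex_hilbert) complex_hilbert
begin

definition "c *\<^sub>C p = (c *\<^sub>C fst p, c *\<^sub>C snd p)"
definition "cinner p q = cinner (fst p) (fst q) + cinner (snd p) (snd q)"

instance
proof
  fix x y :: "'a \<times> 'b"
  show "cinner x y = cnj (cinner y x)"
    using cinner_commute[of "fst x" "fst y"] cinner_commute[of "snd x" "snd y"]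
    by (simp add: cinner_prod_def)
qed (auto simp: scaleC_prod_def cinner_prod_def scaleC_add_right scaleC_add_left scaleC_scaleC
      scaleC_of_real cinner_add_left cinner_scaleC_left cinner_self norm_prod_def algebra_simps
      prod_eq_iff)

end

definition csubspace :: "'a::complex_hilbert set \<Rightarrow> bool" where
  "csubspace S \<longleftrightarrow>
     0 \<in> S \<and> (\<forall>x\<in>S. \<forall>y\<in>S. x + y \<in> S) \<and> (\<forall>c. \<forall>x\<in>S. c *\<^sub>C x \<in> S)"


section \<open>Unbounded linear operators\<close>

text \<open>An operator with domain \<open>D\<close> is represented by its graph \<open>{(f, G f) | f \<in> D}\<close>. Thus
  \<^const>\<open>Domain\<close> is its domain, \<^const>\<open>converse\<close> its inverse, inclusion is the extension relation,
  and \<open>r O s\<close> means: first \<open>r\<close>, then \<open>s\<close>.\<close>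

definition linear_operator :: "('a::complex_hilbert \<times> 'a) set \<Rightarrow> bool" where
  "linear_operator G \<longleftrightarrow> single_valued G \<and> csubspace G"

definition op_app :: "('a \<times> 'a) set \<Rightarrow> 'a \<Rightarrow> 'a" where
  "op_app G f = (THE g. (f, g) \<in> G)"

definition op_of :: "('a \<Rightarrow> 'a) \<Rightarrow> ('a \<times> 'a) set" where
  "op_of A = {(f, A f) | f. True}"

definition op_plus :: "('a::plus \<times> 'a) set \<Rightarrow> ('a \<times> 'a) set \<Rightarrow> ('a \<times> 'a) set" where
  "op_plus A B = {(f, g + h) | f g h. (f, g) \<in> A \<and> (f, h) \<in> B}"

definition op_minus :: "('a::minus \<times> 'a) set \<Rightarrow> ('a \<times> 'a) set \<Rightarrow> ('a \<times> 'a) set" where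
  "op_minus A B = {(f, g - h) | f g h. (f, g) \<in> A \<and> (f, h) \<in> B}"

definition adjoint_op :: "('a::complex_hilbert \<times> 'a) set \<Rightarrow> ('a \<times> 'a) set" where
  "adjoint_op G = {(u, v). \<forall>(f, g) \<in> G. cinner g u = cinner f v}"

definition self_adjoint :: "('a::complex_hilbert \<times> 'a) set \<Rightarrow> bool" where
  "self_adjoint G \<longleftrightarrow>
     linear_operator G \<and> closure (Domain G) = UNIV \<and> adjoint_op G = G"

text \<open>The order on \<^typ>\<open>complex\<close> is that of \<^theory>\<open>HOL-Library.Complex_Order\<close>: \<open>0 < z\<close> says that \<open>z\<close>
  is real and positive.\<close>

definition positive_op :: "('a::complex_hilbert \<times> 'a) set \<Rightarrow> bool" where
  "positive_op G \<longleftrightarrow> (\<forall>f \<in> Domain G. f \<noteq> 0 \<longrightarrow> 0 < cinner (op_app G f) f)"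

definition nonnegative_op :: "('a::complex_hilbert \<times> 'a) set \<Rightarrow> bool" where
  "nonnegative_op G \<longleftrightarrow> (\<forall>f \<in> Domain G. 0 \<le> cinner (op_app G f) f)"


section \<open>Krein spaces and dual definite subspaces\<close>

definition fundamental_symmetry :: "('a::complex_hilbert \<Rightarrow> 'a) \<Rightarrow> bool" where
  "fundamental_symmetry J \<longleftrightarrow>
     bounded_linear J \<and> (\<forall>c f. J (c *\<^sub>C f) = c *\<^sub>C J f) \<and>
     (\<forall>f g. cinner (J f) g = cinner f (J g)) \<and> (\<forall>f. J (J f) = f) \<and>
     J \<noteq> (\<lambda>f. f) \<and> J \<noteq> (\<lambda>f. - f)"

definition krein :: "('a::complex_hilbert \<Rightarrow> 'a) \<Rightarrow> 'a \<Rightarrow> 'a \<Rightarrow> complex" where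
  "krein J f g = cinner (J f) g"

definition P_plus :: "('a::complex_hilbert \<Rightarrow> 'a) \<Rightarrow> 'a \<Rightarrow> 'a" where
  "P_plus J f = (1/2) *\<^sub>R (f + J f)"

definition P_minus :: "('a::complex_hilbert \<Rightarrow> 'a) \<Rightarrow> 'a \<Rightarrow> 'a" where
  "P_minus J f = (1/2) *\<^sub>R (f - J f)"

definition dual_definite :: "('a::complex_hilbert \<Rightarrow> 'a) \<Rightarrow> 'a set \<Rightarrow> 'a set \<Rightarrow> bool" where
  "dual_definite J Lp Lm \<longleftrightarrow>
     csubspace Lp \<and> closed Lp \<and> csubspace Lm \<and> closed Lm \<and>
     (\<forall>f\<in>Lp. f \<noteq> 0 \<longrightarrow> 0 < krein J f f) \<and>
     (\<forall>f\<in>Lm. f \<noteq> 0 \<longrightarrow> krein J f f < 0) \<and>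
     (\<forall>f\<in>Lp. \<forall>g\<in>Lm. krein J f g = 0)"

text \<open>The angular operators \<open>K\<^sub>+\<^sup>- : M\<^sub>+ \<rightarrow> H\<^sub>-\<close> and \<open>K\<^sub>-\<^sup>+ : M\<^sub>- \<rightarrow> H\<^sub>+\<close>, determined by
  \<open>L\<^sub>+ = {x + K\<^sub>+\<^sup>- x | x \<in> M\<^sub>+}\<close> and \<open>L\<^sub>- = {x + K\<^sub>-\<^sup>+ x | x \<in> M\<^sub>-}\<close>.\<close>

definition K_plus :: "('a::complex_hilbert \<Rightarrow> 'a) \<Rightarrow> 'a set \<Rightarrow> ('a \<times> 'a) set" where
  "K_plus J Lp = {(x, y). x \<in> range (P_plus J) \<and> y \<in> range (P_minus J) \<and> x + y \<in> Lp}"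

definition K_minus :: "('a::complex_hilbert \<Rightarrow> 'a) \<Rightarrow> 'a set \<Rightarrow> ('a \<times> 'a) set" where
  "K_minus J Lm = {(x, y). x \<in> range (P_minus J) \<and> y \<in> range (P_plus J) \<and> x + y \<in> Lm}"

definition T0 :: "('a::complex_hilbert \<Rightarrow> 'a) \<Rightarrow> 'a set \<Rightarrow> 'a set \<Rightarrow> ('a \<times> 'a) set" where
  "T0 J Lp Lm =
     op_plus (op_of (P_plus J) O K_plus J Lp) (op_of (P_minus J) O K_minus J Lm)"

definition G0 :: "('a::complex_hilbert \<Rightarrow> 'a) \<Rightarrow> 'a set \<Rightarrow> 'a set \<Rightarrow> ('a \<times> 'a) set" where
  "G0 J Lp Lm = (op_plus Id (T0 J Lp Lm))\<inverse> O op_minus Id (T0 J Lp Lm)"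

lemma fundamental_symmetryD:
  assumes "fundamental_symmetry J"
  shows "J (f + g) = J f + J g" "J (f - g) = J f - J g" "J (r *\<^sub>R f) = r *\<^sub>R J f" "J (J f) = f"
  using assms by (auto simp: fundamental_symmetry_def linear_simps)

lemma P_range:
  assumes "fundamental_symmetry J"
  shows "x \<in> range (P_plus J) \<longleftrightarrow> J x = x" "x \<in> range (P_minus J) \<longleftrightarrow> J x = - x"
proof -
  have 1: "J (P_plus J f) = P_plus J f" "J (P_minus J f) = - P_minus J f" for f
    by (auto simp: P_plus_def P_minus_def fundamental_symmetryD[OF assms] algebra_simps)
  have "P_plus J x = x" if "J x = x"
    using that by (simp add: P_plus_def flip: scaleR_2)
  moreover have "P_minus J x = x" if "J x = - x"
    using that by (simp add: P_minus_def flip: scaleR_2)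
  ultimately show "x \<in> range (P_plus J) \<longleftrightarrow> J x = x" "x \<in> range (P_minus J) \<longleftrightarrow> J x = - x"
    using 1 by (metis rangeE rangeI)+
qed

lemma csubspaceD:
  assumes "csubspace S"
  shows "0 \<in> S" "x \<in> S \<Longrightarrow> y \<in> S \<Longrightarrow> x + y \<in> S" "x \<in> S \<Longrightarrow> c *\<^sub>C x \<in> S"
    "x \<in> S \<Longrightarrow> r *\<^sub>R x \<in> S" "x \<in> S \<Longrightarrow> - x \<in> S" "x \<in> S \<Longrightarrow> y \<in> S \<Longrightarrow> x - y \<in> S"
proof -
  show *: "0 \<in> S" "x \<in> S \<Longrightarrow> y \<in> S \<Longrightarrow> x + y \<in> S" "x \<in> S \<Longrightarrow> c *\<^sub>C x \<in> S" for x y c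
    using assms by (auto simp: csubspace_def)
  show **: "x \<in> S \<Longrightarrow> r *\<^sub>R x \<in> S" for x r
    using *(3)[of x "complex_of_real r"] by (simp add: scaleC_of_real)
  show ***: "x \<in> S \<Longrightarrow> - x \<in> S" for x
    using **[of x "-1"] by simp
  show "x \<in> S \<Longrightarrow> y \<in> S \<Longrightarrow> x - y \<in> S"
    using *(2)[of x "- y"] ***[of y] by simp
qed

lemma cinner_minus_left: "cinner (- x) y = - cinner x (y::'a::complex_hilbert)"
  using cinner_scaleC_left[of "-1" x y] scaleC_of_real[of "-1" x] by simp

lemma G0_eq:
  assumes J: "fundamental_symmetry J" and L: "dual_definite J Lp Lm"
  shows "G0 J Lp Lm = {(f + g, J (f - g)) | f g. f \<in> Lp \<and> g \<in> Lm}"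
proof -
  note J_simps = fundamental_symmetryD[OF J]
  have Jp: "J (P_plus J f) = P_plus J f" and Jm: "J (P_minus J f) = - P_minus J f" for f
    by (auto simp: P_plus_def P_minus_def J_simps algebra_simps)
  have T: "(x, y) \<in> T0 J Lp Lm \<longleftrightarrow>
      (\<exists>u v. P_plus J x + u \<in> Lp \<and> P_minus J x + v \<in> Lm \<and> J u = - u \<and> J v = v \<and> y = u + v)" for x y
    by (auto simp: T0_def op_plus_def op_of_def K_plus_def K_minus_def P_range[OF J]
        relcomp_unfold Jp Jm)
  have Lp: "csubspace Lp" "f \<in> Lp \<Longrightarrow> f \<noteq> 0 \<Longrightarrow> 0 < krein J f f"
    and Lm: "csubspace Lm" "f \<in> Lm \<Longrightarrow> f \<noteq> 0 \<Longrightarrow> krein J f f < 0" for f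
    using L by (auto simp: dual_definite_def)
  have up: "u = u'" if "x + u \<in> Lp" "x + u' \<in> Lp" "J u = - u" "J u' = - u'" for x u u'
  proof (rule ccontr)
    assume "u \<noteq> u'"
    moreover have "u - u' \<in> Lp"
      using csubspaceD(6)[OF Lp(1) that(1,2)] by simp
    ultimately have "0 < krein J (u - u') (u - u')"
      using Lp(2)[of "u - u'"] by simp
    moreover have "J (u - u') = - (u - u')"
      using that by (simp add: J_simps)
    ultimately show False
      by (simp add: krein_def cinner_minus_left cinner_self less_complex_def
          del: minus_diff_eq of_real_power)
  qed
  have um: "u = u'" if "x + u \<in> Lm" "x + u' \<in> Lm" "J u = u" "J u' = u'" for x u u'
  proof (rule ccontr)
    assume "u \<noteq> u'"
    moreover have "u - u' \<in> Lm"
      using csubspaceD(6)[OF Lm(1) that(1,2)] by simp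
    ultimately have "krein J (u - u') (u - u') < 0"
      using Lm(2)[of "u - u'"] by simp
    moreover have "J (u - u') = u - u'"
      using that by (simp add: J_simps)
    ultimately show False
      by (simp add: krein_def cinner_self less_complex_def del: of_real_power)
  qed
  have PP: "P_plus J x + P_minus J x = x" for x
    by (simp add: P_plus_def P_minus_def algebra_simps flip: scaleR_left.add)
  have T_fun: "y = y'" if "(x, y) \<in> T0 J Lp Lm" "(x, y') \<in> T0 J Lp Lm" for x y y'
    using that up um unfolding T by blast
  have G: "(a, b) \<in> G0 J Lp Lm \<longleftrightarrow> (\<exists>x y. (x, y) \<in> T0 J Lp Lm \<and> a = x + y \<and> b = x - y)" for a b
  proof -
    have "(a, b) \<in> G0 J Lp Lm \<longleftrightarrow> (\<exists>x y y'. (x, y) \<in> T0 J Lp Lm \<and> (x, y') \<in> T0 J Lp Lm \<and>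
        a = x + y \<and> b = x - y')"
      by (auto simp: G0_def op_plus_def op_minus_def)
    then show ?thesis
      using T_fun by metis
  qed
  have "(a, b) \<in> G0 J Lp Lm \<longleftrightarrow> (\<exists>f\<in>Lp. \<exists>g\<in>Lm. a = f + g \<and> b = J (f - g))" for a b
  proof
    assume "(a, b) \<in> G0 J Lp Lm"
    then obtain x u v where *: "P_plus J x + u \<in> Lp" "P_minus J x + v \<in> Lm" "J u = - u" "J v = v"
        "a = x + (u + v)" "b = x - (u + v)"
      unfolding G T by blast
    have "J ((P_plus J x + u) - (P_minus J x + v)) = (P_plus J x + P_minus J x) - (u + v)"
      by (simp add: J_simps Jp Jm *(3,4))
    moreover have "(P_plus J x + u) + (P_minus J x + v) = (P_plus J x + P_minus J x) + (u + v)"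
      by (simp add: algebra_simps)
    ultimately show "\<exists>f\<in>Lp. \<exists>g\<in>Lm. a = f + g \<and> b = J (f - g)"
      using * by (metis PP)
  next
    assume "\<exists>f\<in>Lp. \<exists>g\<in>Lm. a = f + g \<and> b = J (f - g)"
    then obtain f g where fg: "f \<in> Lp" "g \<in> Lm" "a = f + g" "b = J (f - g)"
      by blast
    define x where "x = P_plus J f + P_minus J g"
    have x: "P_plus J x = P_plus J f" "P_minus J x = P_minus J g"
      by (simp_all add: x_def P_plus_def[of J "_ + _"] P_minus_def[of J "_ + _"] J_simps Jp Jm
          flip: scaleR_2)
    have "(x, P_minus J f + P_plus J g) \<in> T0 J Lp Lm"
      unfolding T x using PP[of f] PP[of g] fg(1,2) Jp Jm by (metis add.commute)
    moreover have "a = x + (P_minus J f + P_plus J g)"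
    proof -
      have "a = (P_plus J f + P_minus J f) + (P_plus J g + P_minus J g)"
        by (simp add: fg(3) PP)
      then show ?thesis
        by (simp add: x_def)
    qed
    moreover have "b = x - (P_minus J f + P_plus J g)"
    proof -
      have "b = J ((P_plus J f + P_minus J f) - (P_plus J g + P_minus J g))"
        by (simp add: fg(4) PP)
      also have "\<dots> = x - (P_minus J f + P_plus J g)"
        by (simp add: J_simps Jp Jm x_def)
      finally show ?thesis .
    qed
    ultimately show "(a, b) \<in> G0 J Lp Lm"
      unfolding G by blast
  qed
  then show ?thesis
    by (intro set_eqI) (simp only: split_paired_all mem_Collect_eq prod.inject Bex_def, blast)
qed


section \<open>Completion of a pre-Hilbert space\<close>

text \<open>The completion of a subspace \<open>D\<close> with respect to an inner product \<open>ip\<close> on \<open>D\<close>, realised as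
  the Cauchy sequences modulo the null sequences.\<close>

definition ip_norm :: "('a \<Rightarrow> 'a \<Rightarrow> complex) \<Rightarrow> 'a \<Rightarrow> real" where
  "ip_norm ip f = sqrt (Re (ip f f))"

definition cauchy_seqs :: "'a::minus set \<Rightarrow> ('a \<Rightarrow> 'a \<Rightarrow> complex) \<Rightarrow> (nat \<Rightarrow> 'a) set" where
  "cauchy_seqs D ip = {s. range s \<subseteq> D \<and>
     (\<forall>\<epsilon>>0. \<exists>N. \<forall>m\<ge>N. \<forall>n\<ge>N. ip_norm ip (s m - s n) < \<epsilon>)}"

definition cauchy_rel ::
    "'a::minus set \<Rightarrow> ('a \<Rightarrow> 'a \<Rightarrow> complex) \<Rightarrow> ((nat \<Rightarrow> 'a) \<times> (nat \<Rightarrow> 'a)) set" where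
  "cauchy_rel D ip = {(s, t). s \<in> cauchy_seqs D ip \<and> t \<in> cauchy_seqs D ip \<and>
     (\<lambda>n. ip_norm ip (s n - t n)) \<longlonglongrightarrow> 0}"

definition completion :: "'a::minus set \<Rightarrow> ('a \<Rightarrow> 'a \<Rightarrow> complex) \<Rightarrow> (nat \<Rightarrow> 'a) set set" where
  "completion D ip = cauchy_seqs D ip // cauchy_rel D ip"

definition completion_embed ::
    "'a::minus set \<Rightarrow> ('a \<Rightarrow> 'a \<Rightarrow> complex) \<Rightarrow> 'a \<Rightarrow> (nat \<Rightarrow> 'a) set" where
  "completion_embed D ip f = cauchy_rel D ip `` {\<lambda>n. f}"

text \<open>The operations on classes are defined through representatives; the choice is immaterial by
  \<open>completion_inner_class\<close> and \<open>completion_minus_class\<close> below.\<close>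

definition rep :: "(nat \<Rightarrow> 'a) set \<Rightarrow> nat \<Rightarrow> 'a" where
  "rep X = (SOME s. s \<in> X)"

definition completion_inner ::
    "('a \<Rightarrow> 'a \<Rightarrow> complex) \<Rightarrow> (nat \<Rightarrow> 'a) set \<Rightarrow> (nat \<Rightarrow> 'a) set \<Rightarrow> complex" where
  "completion_inner ip X Y = lim (\<lambda>n. ip (rep X n) (rep Y n))"

definition completion_minus ::
    "'a::minus set \<Rightarrow> ('a \<Rightarrow> 'a \<Rightarrow> complex) \<Rightarrow>
     (nat \<Rightarrow> 'a) set \<Rightarrow> (nat \<Rightarrow> 'a) set \<Rightarrow> (nat \<Rightarrow> 'a) set" where
  "completion_minus D ip X Y = cauchy_rel D ip `` {\<lambda>n. rep X n - rep Y n}"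

text \<open>The locale \<^locale>\<open>Metric_space\<close> requires the distance to be symmetric and nonnegative off the
  carrier as well, hence the default value.\<close>

definition completion_dist ::
    "'a::minus set \<Rightarrow> ('a \<Rightarrow> 'a \<Rightarrow> complex) \<Rightarrow> (nat \<Rightarrow> 'a) set \<Rightarrow> (nat \<Rightarrow> 'a) set \<Rightarrow> real" where
  "completion_dist D ip X Y =
     (if X \<in> completion D ip \<and> Y \<in> completion D ip
      then ip_norm (completion_inner ip) (completion_minus D ip X Y) else 0)"

definition dense_in_completion ::
    "'a::minus set \<Rightarrow> ('a \<Rightarrow> 'a \<Rightarrow> complex) \<Rightarrow> 'a set \<Rightarrow> bool" where
  "dense_in_completion D ip S \<longleftrightarrow>
     Metric_space.mtopology (completion D ip) (completion_dist D ip) closure_of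
       (completion_embed D ip ` S) = completion D ip"

locale pre_hilbert =
  fixes D :: "'a::complex_hilbert set" and ip :: "'a \<Rightarrow> 'a \<Rightarrow> complex"
  assumes D: "csubspace D"
    and add_left: "\<lbrakk>f \<in> D; g \<in> D; h \<in> D\<rbrakk> \<Longrightarrow> ip (f + g) h = ip f h + ip g h"
    and scale_left: "\<lbrakk>f \<in> D; h \<in> D\<rbrakk> \<Longrightarrow> ip (c *\<^sub>C f) h = c * ip f h"
    and commute: "\<lbrakk>f \<in> D; g \<in> D\<rbrakk> \<Longrightarrow> ip f g = cnj (ip g f)"
    and pos: "\<lbrakk>f \<in> D; f \<noteq> 0\<rbrakk> \<Longrightarrow> 0 < ip f f"
begin

lemmas D_simps [simp, intro] = csubspaceD[OF D]

abbreviation "N \<equiv> ip_norm ip"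

lemma add_right: "\<lbrakk>f \<in> D; g \<in> D; h \<in> D\<rbrakk> \<Longrightarrow> ip h (f + g) = ip h f + ip h g"
  using add_left commute by (metis complex_cnj_add D_simps(2))

lemma scale_right: "\<lbrakk>f \<in> D; h \<in> D\<rbrakk> \<Longrightarrow> ip h (c *\<^sub>C f) = cnj c * ip h f"
  using scale_left commute by (metis complex_cnj_mult D_simps(3))

lemma zero [simp]: "f \<in> D \<Longrightarrow> ip 0 f = 0" "f \<in> D \<Longrightarrow> ip f 0 = 0"
  using add_left[of 0 0 f] add_right[of 0 0 f] by auto

lemma minus_left: "\<lbrakk>f \<in> D; h \<in> D\<rbrakk> \<Longrightarrow> ip (- f) h = - ip f h"
  using add_left[of f "-f" h] by (simp add: eq_neg_iff_add_eq_0 add.commute)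

lemma minus_right: "\<lbrakk>f \<in> D; h \<in> D\<rbrakk> \<Longrightarrow> ip h (- f) = - ip h f"
  using add_right[of f "-f" h] by (simp add: eq_neg_iff_add_eq_0 add.commute)

lemma diff_left: "\<lbrakk>f \<in> D; g \<in> D; h \<in> D\<rbrakk> \<Longrightarrow> ip (f - g) h = ip f h - ip g h"
  using add_left[of f "-g" h] by (simp add: minus_left)

lemma diff_right: "\<lbrakk>f \<in> D; g \<in> D; h \<in> D\<rbrakk> \<Longrightarrow> ip h (f - g) = ip h f - ip h g"
  using add_right[of f "-g" h] by (simp add: minus_right)

lemma ip_self: "f \<in> D \<Longrightarrow> ip f f = complex_of_real ((N f)\<^sup>2)"
  using pos[of f] by (cases "f = 0") (auto simp: ip_norm_def less_complex_def complex_eq_iff)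

lemma N_nonneg: "f \<in> D \<Longrightarrow> 0 \<le> N f"
  using pos[of f] by (cases "f = 0") (auto simp: ip_norm_def less_complex_def)

lemma N_eq_0: "f \<in> D \<Longrightarrow> N f = 0 \<longleftrightarrow> f = 0"
  using pos[of f] by (cases "f = 0") (auto simp: ip_norm_def less_complex_def)

lemma N_minus: "f \<in> D \<Longrightarrow> N (- f) = N f"
  by (simp add: ip_norm_def minus_left minus_right)

lemma N_commute: "f \<in> D \<Longrightarrow> g \<in> D \<Longrightarrow> N (f - g) = N (g - f)"
  using N_minus[of "f - g"] by simp

lemma N_scale: "f \<in> D \<Longrightarrow> N (c *\<^sub>C f) = cmod c * N f"
proof -
  assume f: "f \<in> D"
  have "ip (c *\<^sub>C f) (c *\<^sub>C f) = (c * cnj c) * ip f f"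
    using f by (simp add: scale_left scale_right)
  also have "\<dots> = complex_of_real ((cmod c * N f)\<^sup>2)"
    using complex_norm_square[of c] by (simp add: ip_self[OF f] power_mult_distrib)
  finally show ?thesis
    using N_nonneg[OF f] by (simp add: ip_norm_def del: of_real_power of_real_mult)
qed

lemma Cauchy_Schwarz:
  assumes f: "f \<in> D" and g: "g \<in> D"
  shows "cmod (ip f g) \<le> N f * N g"
proof (cases "g = 0")
  case True
  then show ?thesis using f by (simp add: ip_norm_def)
next
  case False
  define a where "a = ip f g / ip g g"
  have gg: "ip g g \<noteq> 0"
    using pos[OF g False] by auto
  have "0 \<le> Re (ip (f - a *\<^sub>C g) (f - a *\<^sub>C g))"
    using ip_self[of "f - a *\<^sub>C g"] f g by simp
  also have "ip (f - a *\<^sub>C g) (f - a *\<^sub>C g) = ip f f - cnj a * ip f g - a * (ip g f - cnj a * ip g g)"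
    using f g by (simp add: diff_left diff_right scale_left scale_right algebra_simps)
  also have "cnj a * ip g g = ip g f"
  proof -
    have "cnj (ip g g) = ip g g"
      using commute[OF g g] by simp
    then show ?thesis
      using gg commute[OF g f] by (simp add: a_def)
  qed
  also have "ip f f - cnj a * ip f g - a * (ip g f - ip g f) = ip f f - ip f g * cnj (ip f g) / cnj (ip g g)"
    by (simp add: a_def)
  also have "\<dots> = complex_of_real ((N f)\<^sup>2 - (cmod (ip f g))\<^sup>2 / (N g)\<^sup>2)"
    by (simp add: ip_self[OF f] ip_self[OF g] complex_norm_square[symmetric])
  finally have "(cmod (ip f g))\<^sup>2 / (N g)\<^sup>2 \<le> (N f)\<^sup>2"
    by simp
  moreover have "N g > 0"
    using N_nonneg[OF g] N_eq_0[OF g] False by linarith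
  ultimately have "(cmod (ip f g))\<^sup>2 \<le> (N f * N g)\<^sup>2"
    by (simp add: divide_le_eq power_mult_distrib)
  then show ?thesis
    by (rule power2_le_imp_le) (use f g N_nonneg in simp)
qed

lemma N_triangle:
  assumes f: "f \<in> D" and g: "g \<in> D"
  shows "N (f + g) \<le> N f + N g"
proof -
  have "complex_of_real ((N (f + g))\<^sup>2) = ip (f + g) (f + g)"
    using ip_self f g by simp
  also have "\<dots> = ip f f + ip g g + (ip f g + cnj (ip f g))"
    using f g commute[of g f] by (simp add: add_left add_right)
  also have "\<dots> = complex_of_real ((N f)\<^sup>2 + (N g)\<^sup>2 + 2 * Re (ip f g))"
    by (simp add: ip_self[OF f] ip_self[OF g] complex_add_cnj)
  finally have "(N (f + g))\<^sup>2 = (N f)\<^sup>2 + (N g)\<^sup>2 + 2 * Re (ip f g)"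
    using of_real_eq_iff by blast
  moreover have "Re (ip f g) \<le> N f * N g"
    using Cauchy_Schwarz[OF f g] complex_Re_le_cmod order_trans by blast
  ultimately have "(N (f + g))\<^sup>2 \<le> (N f + N g)\<^sup>2"
    by (simp add: power2_sum)
  then show ?thesis
    by (rule power2_le_imp_le) (use f g N_nonneg in simp)
qed

lemma N_triangle_diff:
  assumes "f \<in> D" "g \<in> D" "h \<in> D"
  shows "N (f - h) \<le> N (f - g) + N (g - h)"
  using N_triangle[of "f - g" "g - h"] assms by simp

lemma N_lipschitz: 
  assumes "f \<in> D" "g \<in> D"
  shows "\<bar>N f - N g\<bar> \<le> N (f - g)"
  using N_triangle[of "f - g" g] N_triangle[of "g - f" f] N_commute[of f g] assms by simp

abbreviation "CS \<equiv> cauchy_seqs D ip"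
abbreviation "CR \<equiv> cauchy_rel D ip"

lemma CS_D [simp, intro]: "s \<in> CS \<Longrightarrow> s n \<in> D"
  by (auto simp: cauchy_seqs_def)

lemma CS_cauchy: "\<lbrakk>s \<in> CS; 0 < e\<rbrakk> \<Longrightarrow> \<exists>K. \<forall>m\<ge>K. \<forall>n\<ge>K. N (s m - s n) < e"
  by (auto simp: cauchy_seqs_def)

lemma CS_const [simp]: "f \<in> D \<Longrightarrow> (\<lambda>n. f) \<in> CS"
  by (auto simp: cauchy_seqs_def ip_norm_def)

lemma CS_diff:
  assumes s: "s \<in> CS" and t: "t \<in> CS"
  shows "(\<lambda>n. s n - t n) \<in> CS"
  unfolding cauchy_seqs_def
proof (intro CollectI conjI allI impI)
  show "range (\<lambda>n. s n - t n) \<subseteq> D"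
    using s t by auto
next
  fix e :: real assume "e > 0"
  then obtain K L where K: "\<forall>m\<ge>K. \<forall>n\<ge>K. N (s m - s n) < e / 2" and L: "\<forall>m\<ge>L. \<forall>n\<ge>L. N (t m - t n) < e / 2"
    using CS_cauchy[OF s, of "e / 2"] CS_cauchy[OF t, of "e / 2"] by auto
  have "N (s m - t m - (s n - t n)) < e" if "m \<ge> max K L" "n \<ge> max K L" for m n
  proof -
    have "N (s m - t m - (s n - t n)) = N ((s m - s n) + (t n - t m))"
      by (simp add: algebra_simps)
    also have "\<dots> \<le> N (s m - s n) + N (t n - t m)"
      using s t by (intro N_triangle) auto
    also have "\<dots> < e"
      using K[rule_format, of m n] L[rule_format, of n m] that by simp
    finally show ?thesis .
  qed
  then show "\<exists>K. \<forall>m\<ge>K. \<forall>n\<ge>K. N (s m - t m - (s n - t n)) < e"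
    by blast
qed

lemma CS_N_convergent:
  assumes s: "s \<in> CS"
  shows "convergent (\<lambda>n. N (s n))"
proof (rule Cauchy_convergent, rule metric_CauchyI)
  fix e :: real assume "e > 0"
  then obtain K where "\<forall>m\<ge>K. \<forall>n\<ge>K. N (s m - s n) < e"
    using CS_cauchy[OF s] by blast
  then show "\<exists>K. \<forall>m\<ge>K. \<forall>n\<ge>K. dist (N (s m)) (N (s n)) < e"
    using N_lipschitz s by (metis CS_D dist_real_def order_le_less_trans)
qed

lemma CS_bounded:
  assumes s: "s \<in> CS"
  obtains B where "B > 0" "\<And>n. N (s n) \<le> B"
proof -
  have "Bseq (\<lambda>n. N (s n))"
    using CS_N_convergent[OF s] convergent_imp_Bseq by blast
  then obtain B where "B > 0" "\<And>n. norm (N (s n)) \<le> B"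
    by (auto simp: Bseq_def)
  then show ?thesis
    using that by (metis abs_le_D1 real_norm_def)
qed

lemma CS_inner_convergent:
  assumes s: "s \<in> CS" and t: "t \<in> CS"
  shows "convergent (\<lambda>n. ip (s n) (t n))"
proof -
  obtain A where A: "A > 0" "\<And>n. N (s n) \<le> A" using CS_bounded[OF s] by metis
  obtain B where B: "B > 0" "\<And>n. N (t n) \<le> B" using CS_bounded[OF t] by metis
  show ?thesis
  proof (rule Cauchy_convergent, rule metric_CauchyI)
    fix e :: real assume "e > 0"
    then have e: "e / (2 * B) > 0" "e / (2 * A) > 0"
      using A B by auto
    obtain K L where K: "\<forall>m\<ge>K. \<forall>n\<ge>K. N (s m - s n) < e / (2 * B)"
      and L: "\<forall>m\<ge>L. \<forall>n\<ge>L. N (t m - t n) < e / (2 * A)"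
      using CS_cauchy[OF s e(1)] CS_cauchy[OF t e(2)] by auto
    have "dist (ip (s m) (t m)) (ip (s n) (t n)) < e" if mn: "m \<ge> max K L" "n \<ge> max K L" for m n
    proof -
      have "ip (s m) (t m) - ip (s n) (t n) = ip (s m - s n) (t m) + ip (s n) (t m - t n)"
        using s t by (simp add: diff_left diff_right)
      then have "dist (ip (s m) (t m)) (ip (s n) (t n))
          \<le> cmod (ip (s m - s n) (t m)) + cmod (ip (s n) (t m - t n))"
        by (simp add: dist_norm norm_triangle_ineq)
      also have "\<dots> \<le> N (s m - s n) * N (t m) + N (s n) * N (t m - t n)"
        using s t by (intro add_mono Cauchy_Schwarz) auto
      also have "\<dots> \<le> N (s m - s n) * B + A * N (t m - t n)"
        using s t A B by (intro add_mono mult_left_mono mult_right_mono N_nonneg) auto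
      also have "\<dots> < e / (2 * B) * B + A * (e / (2 * A))"
        using K L mn A(1) B(1) by (intro add_strict_mono mult_strict_right_mono mult_strict_left_mono) auto
      also have "\<dots> = e"
        using A B by simp
      finally show ?thesis .
    qed
    then show "\<exists>K. \<forall>m\<ge>K. \<forall>n\<ge>K. dist (ip (s m) (t m)) (ip (s n) (t n)) < e"
      by blast
  qed
qed

lemma equiv_CR: "equiv CS CR"
proof (rule equivI)
  show "CR \<subseteq> CS \<times> CS"
    by (auto simp: cauchy_rel_def)
  show "refl_on CS CR"
    by (auto simp: refl_on_def cauchy_rel_def ip_norm_def)
  show "sym CR"
  proof (rule symI)
    fix s t assume st: "(s, t) \<in> CR"
    then have "(\<lambda>n. N (t n - s n)) = (\<lambda>n. N (s n - t n))"
      using N_commute by (fastforce simp: cauchy_rel_def)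
    with st show "(t, s) \<in> CR"
      by (auto simp: cauchy_rel_def)
  qed
  show "trans CR"
  proof (rule transI)
    fix s t u assume *: "(s, t) \<in> CR" "(t, u) \<in> CR"
    then have D: "s n \<in> D" "t n \<in> D" "u n \<in> D" for n
      by (auto simp: cauchy_rel_def)
    have "(\<lambda>n. N (s n - t n) + N (t n - u n)) \<longlonglongrightarrow> 0"
      using * tendsto_add[of "\<lambda>n. N (s n - t n)" 0 sequentially "\<lambda>n. N (t n - u n)" 0]
      by (auto simp: cauchy_rel_def)
    then have "(\<lambda>n. N (s n - u n)) \<longlonglongrightarrow> 0"
      by (rule tendsto_sandwich[OF _ _ tendsto_const, rotated 2])
        (auto intro!: always_eventually N_nonneg N_triangle_diff D)
    then show "(s, u) \<in> CR"
      using * by (auto simp: cauchy_rel_def)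
  qed
qed

lemma class_in_completion: "s \<in> CS \<Longrightarrow> CR `` {s} \<in> completion D ip"
  by (auto simp: completion_def quotientI)

lemma completion_cases:
  assumes "X \<in> completion D ip"
  obtains s where "s \<in> CS" "X = CR `` {s}"
  using assms by (auto simp: completion_def elim: quotientE)

lemma rep_rel: "s \<in> CS \<Longrightarrow> (s, rep (CR `` {s})) \<in> CR"
  using someI[of "\<lambda>t. t \<in> CR `` {s}" s] equiv_class_self[OF equiv_CR]
  by (auto simp: rep_def)

lemma CR_CS: "(s, t) \<in> CR \<Longrightarrow> s \<in> CS" "(s, t) \<in> CR \<Longrightarrow> t \<in> CS"
  by (auto simp: cauchy_rel_def)

lemma completion_inner_class:
  assumes s: "s \<in> CS" and t: "t \<in> CS"
  shows "(\<lambda>n. ip (s n) (t n)) \<longlonglongrightarrow> completion_inner ip (CR `` {s}) (CR `` {t})"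
proof -
  define s' t' where "s' = rep (CR `` {s})" and "t' = rep (CR `` {t})"
  have rel: "(s, s') \<in> CR" "(t, t') \<in> CR"
    using rep_rel s t by (auto simp: s'_def t'_def)
  then have s': "s' \<in> CS" and t': "t' \<in> CS"
    by (auto dest: CR_CS)
  obtain A where A: "A > 0" "\<And>n. N (s n) \<le> A" using CS_bounded[OF s] by metis
  obtain B where B: "B > 0" "\<And>n. N (t' n) \<le> B" using CS_bounded[OF t'] by metis
  have lim: "(\<lambda>n. N (s n - s' n) * B + A * N (t n - t' n)) \<longlonglongrightarrow> 0 * B + A * 0"
    using rel by (intro tendsto_intros) (auto simp: cauchy_rel_def)
  have bound: "cmod (ip (s n) (t n) - ip (s' n) (t' n)) \<le> N (s n - s' n) * B + A * N (t n - t' n)" for n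
  proof -
    have "ip (s n) (t n) - ip (s' n) (t' n) = ip (s n - s' n) (t' n) + ip (s n) (t n - t' n)"
      using s t s' t' by (simp add: diff_left diff_right)
    then have "cmod (ip (s n) (t n) - ip (s' n) (t' n))
        \<le> cmod (ip (s n - s' n) (t' n)) + cmod (ip (s n) (t n - t' n))"
      by (simp add: norm_triangle_ineq)
    also have "\<dots> \<le> N (s n - s' n) * N (t' n) + N (s n) * N (t n - t' n)"
      using s t s' t' by (intro add_mono Cauchy_Schwarz) auto
    also have "\<dots> \<le> N (s n - s' n) * B + A * N (t n - t' n)"
      using s t s' t' A B by (intro add_mono mult_left_mono mult_right_mono N_nonneg) auto
    finally show ?thesis .
  qed
  have "(\<lambda>n. ip (s n) (t n) - ip (s' n) (t' n)) \<longlonglongrightarrow> 0"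
    by (rule Lim_null_comparison[OF always_eventually lim[simplified]]) (use bound in blast)
  moreover have "(\<lambda>n. ip (s' n) (t' n)) \<longlonglongrightarrow> completion_inner ip (CR `` {s}) (CR `` {t})"
    using CS_inner_convergent[OF s' t']
    by (simp add: completion_inner_def s'_def t'_def convergent_LIMSEQ_iff)
  ultimately have "(\<lambda>n. ip (s n) (t n) - ip (s' n) (t' n) + ip (s' n) (t' n))
      \<longlonglongrightarrow> 0 + completion_inner ip (CR `` {s}) (CR `` {t})"
    by (rule tendsto_add)
  then show ?thesis
    by simp
qed

lemma completion_minus_class:
  assumes s: "s \<in> CS" and t: "t \<in> CS"
  shows "completion_minus D ip (CR `` {s}) (CR `` {t}) = CR `` {\<lambda>n. s n - t n}"
proof -
  define s' t' where "s' = rep (CR `` {s})" and "t' = rep (CR `` {t})"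
  have rel: "(s, s') \<in> CR" "(t, t') \<in> CR"
    using rep_rel s t by (auto simp: s'_def t'_def)
  then have s': "s' \<in> CS" and t': "t' \<in> CS"
    by (auto dest: CR_CS)
  have lim: "(\<lambda>n. N (s n - s' n) + N (t n - t' n)) \<longlonglongrightarrow> 0 + 0"
    using rel by (intro tendsto_intros) (auto simp: cauchy_rel_def)
  have bound: "N (s n - t n - (s' n - t' n)) \<le> N (s n - s' n) + N (t n - t' n)" for n
  proof -
    have "N (s n - t n - (s' n - t' n)) = N ((s n - s' n) + (t' n - t n))"
      by (simp add: algebra_simps)
    also have "\<dots> \<le> N (s n - s' n) + N (t' n - t n)"
      using s t s' t' by (intro N_triangle) auto
    finally show ?thesis
      using N_commute[of "t n" "t' n"] t t' by simp
  qed
  have "norm (N (s n - t n - (s' n - t' n))) \<le> N (s n - s' n) + N (t n - t' n)" for n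
    using bound[of n] N_nonneg[of "s n - t n - (s' n - t' n)"] s t s' t' by simp
  then have "(\<lambda>n. N (s n - t n - (s' n - t' n))) \<longlonglongrightarrow> 0"
    by (intro Lim_null_comparison[OF always_eventually lim[simplified]]) blast
  then have "(\<lambda>n. s n - t n, \<lambda>n. s' n - t' n) \<in> CR"
    using CS_diff s t s' t' by (auto simp: cauchy_rel_def)
  then show ?thesis
    using equiv_class_eq[OF equiv_CR] by (auto simp: completion_minus_def s'_def t'_def)
qed

lemma completion_dist_class:
  assumes s: "s \<in> CS" and t: "t \<in> CS"
  shows "(\<lambda>n. N (s n - t n)) \<longlonglongrightarrow> completion_dist D ip (CR `` {s}) (CR `` {t})"
proof -
  let ?d = "\<lambda>n. s n - t n"
  have d: "?d \<in> CS"
    using CS_diff s t .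
  have "(\<lambda>n. sqrt (Re (ip (?d n) (?d n)))) \<longlonglongrightarrow>
      sqrt (Re (completion_inner ip (CR `` {?d}) (CR `` {?d})))"
    by (intro tendsto_intros completion_inner_class d)
  then show ?thesis
    by (simp add: completion_dist_def completion_minus_class[OF s t] ip_norm_def
        class_in_completion s t)
qed

lemma completion_embed_inner:
  assumes "f \<in> D" "g \<in> D"
  shows "completion_inner ip (completion_embed D ip f) (completion_embed D ip g) = ip f g"
  using completion_inner_class[of "\<lambda>n. f" "\<lambda>n. g"] assms
  by (simp add: completion_embed_def LIMSEQ_const_iff)

lemma completion_embed_dist:
  assumes "f \<in> D" "g \<in> D"
  shows "completion_dist D ip (completion_embed D ip f) (completion_embed D ip g) = N (f - g)"
  using completion_dist_class[of "\<lambda>n. f" "\<lambda>n. g"] assms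
  by (simp add: completion_embed_def LIMSEQ_const_iff)

sublocale Compl: Metric_space "completion D ip" "completion_dist D ip"
proof
  note cases = completion_cases
  show "0 \<le> completion_dist D ip X Y" for X Y
  proof (cases "X \<in> completion D ip \<and> Y \<in> completion D ip")
    case True
    then obtain s t where s: "s \<in> CS" "X = CR `` {s}" and t: "t \<in> CS" "Y = CR `` {t}"
      by (meson cases)
    show ?thesis
      unfolding s(2) t(2)
      by (rule LIMSEQ_le_const[OF completion_dist_class[OF s(1) t(1)]]) (use s t in \<open>auto intro: N_nonneg\<close>)
  qed (auto simp: completion_dist_def)
  show "completion_dist D ip X Y = completion_dist D ip Y X" for X Y
  proof (cases "X \<in> completion D ip \<and> Y \<in> completion D ip")
    case True
    then obtain s t where s: "s \<in> CS" "X = CR `` {s}" and t: "t \<in> CS" "Y = CR `` {t}"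
      by (meson cases)
    have "(\<lambda>n. N (t n - s n)) = (\<lambda>n. N (s n - t n))"
      using N_commute s t by auto
    then show ?thesis
      using completion_dist_class[OF s(1) t(1)] completion_dist_class[OF t(1) s(1)] LIMSEQ_unique
      unfolding s(2) t(2) by metis
  qed (auto simp: completion_dist_def)
  fix X Y Z
  assume X: "X \<in> completion D ip" and Y: "Y \<in> completion D ip"
  from X obtain s where s: "s \<in> CS" "X = CR `` {s}" by (rule cases)
  from Y obtain t where t: "t \<in> CS" "Y = CR `` {t}" by (rule cases)
  show "completion_dist D ip X Y = 0 \<longleftrightarrow> X = Y"
  proof -
    note lim = completion_dist_class[OF s(1) t(1), folded s(2) t(2)]
    have "X = Y \<longleftrightarrow> (s, t) \<in> CR"
      using eq_equiv_class_iff[OF equiv_CR] s t by auto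
    also have "\<dots> \<longleftrightarrow> (\<lambda>n. N (s n - t n)) \<longlonglongrightarrow> 0"
      using s t by (auto simp: cauchy_rel_def)
    also have "\<dots> \<longleftrightarrow> completion_dist D ip X Y = 0"
      using lim LIMSEQ_unique by metis
    finally show ?thesis by blast
  qed
  assume Z: "Z \<in> completion D ip"
  then obtain u where u: "u \<in> CS" "Z = CR `` {u}" by (rule cases)
  show "completion_dist D ip X Z \<le> completion_dist D ip X Y + completion_dist D ip Y Z"
    unfolding s(2) t(2) u(2)
  proof (rule LIMSEQ_le)
    show "(\<lambda>n. N (s n - u n)) \<longlonglongrightarrow> completion_dist D ip (CR `` {s}) (CR `` {u})"
      by (intro completion_dist_class s u)
    show "(\<lambda>n. N (s n - t n) + N (t n - u n)) \<longlonglongrightarrow>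
        completion_dist D ip (CR `` {s}) (CR `` {t}) + completion_dist D ip (CR `` {t}) (CR `` {u})"
      by (intro tendsto_add completion_dist_class s t u)
    show "\<exists>K. \<forall>n\<ge>K. N (s n - u n) \<le> N (s n - t n) + N (t n - u n)"
      using N_triangle_diff s t u by blast
  qed
qed

lemma completion_embed_in: "f \<in> D \<Longrightarrow> completion_embed D ip f \<in> completion D ip"
  by (simp add: completion_embed_def class_in_completion)

lemma completion_embed_tendsto:
  assumes s: "s \<in> CS"
  shows "(\<lambda>n. completion_dist D ip (completion_embed D ip (s n)) (CR `` {s})) \<longlonglongrightarrow> 0"
proof (rule metric_LIMSEQ_I)
  fix e :: real assume "e > 0"
  then have "e / 2 > 0" by simp
  then obtain K where K: "\<forall>m\<ge>K. \<forall>n\<ge>K. N (s m - s n) < e / 2"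
    using CS_cauchy[OF s] by blast
  have "completion_dist D ip (completion_embed D ip (s n)) (CR `` {s}) \<le> e / 2" if "n \<ge> K" for n
    unfolding completion_embed_def
  proof (rule LIMSEQ_le_const2)
    show "(\<lambda>m. N (s n - s m)) \<longlonglongrightarrow> completion_dist D ip (CR `` {\<lambda>m. s n}) (CR `` {s})"
      using completion_dist_class[of "\<lambda>m. s n" s] s by simp
    show "\<exists>M. \<forall>m\<ge>M. N (s n - s m) \<le> e / 2"
      using K that less_imp_le by blast
  qed
  then show "\<exists>K. \<forall>n\<ge>K. dist (completion_dist D ip (completion_embed D ip (s n)) (CR `` {s})) 0 < e"
    using \<open>e > 0\<close> by (intro exI[of _ K]) (force simp: dist_real_def)
qed

lemma completion_embed_approx:
  assumes "X \<in> completion D ip" "e > 0"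
  obtains f where "f \<in> D" "completion_dist D ip (completion_embed D ip f) X < e"
proof -
  obtain s where s: "s \<in> CS" "X = CR `` {s}"
    using assms by (meson completion_cases)
  obtain n where "dist (completion_dist D ip (completion_embed D ip (s n)) X) 0 < e"
    using metric_LIMSEQ_D[OF completion_embed_tendsto[OF s(1)] assms(2)] s(2) by blast
  then show ?thesis
    using that[of "s n"] s(1) by (simp add: dist_real_def)
qed

lemma completion_embed_dense: "dense_in_completion D ip D"
  unfolding dense_in_completion_def Compl.metric_closure_of Compl.in_mball
  using completion_embed_approx completion_embed_in Compl.commute
  by (smt (verit) Collect_cong Collect_mem_eq image_eqI)

lemma completion_complete: "Compl.mcomplete"
  unfolding Compl.mcomplete_def Compl.limit_metric_sequentially
proof (intro allI impI)
  let ?d = "completion_dist D ip" and ?i = "completion_embed D ip"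
  fix X assume cauchy: "Compl.MCauchy X"
  then have X: "X n \<in> completion D ip" for n
    by (auto simp: Compl.MCauchy_def)
  have "\<exists>f. f \<in> D \<and> ?d (?i f) (X n) < 1 / Suc n" for n
    using completion_embed_approx[OF X[of n], of "1 / Suc n"] by auto
  then obtain s where s: "\<And>n. s n \<in> D" "\<And>n. ?d (?i (s n)) (X n) < 1 / Suc n"
    by metis
  have small: "\<exists>K. \<forall>n\<ge>K. 1 / Suc n < e" if "e > 0" for e :: real
    using order_tendstoD(2)[OF LIMSEQ_Suc[OF lim_1_over_n] that] by (simp add: eventually_sequentially)
  have i_s: "?i (s n) \<in> completion D ip" for n
    using s(1) completion_embed_in by blast
  have "s \<in> CS"
    unfolding cauchy_seqs_def
  proof (intro CollectI conjI allI impI)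
    fix e :: real assume "e > 0"
    then have e: "e / 3 > 0" by simp
    obtain K where K: "\<forall>n\<ge>K. 1 / Suc n < e / 3"
      using small[OF e] by blast
    obtain L where L: "\<forall>m n. L \<le> m \<longrightarrow> L \<le> n \<longrightarrow> ?d (X m) (X n) < e / 3"
      using cauchy e unfolding Compl.MCauchy_def by blast
    have "N (s m - s n) < e" if mn: "m \<ge> max K L" "n \<ge> max K L" for m n
    proof -
      have "N (s m - s n) = ?d (?i (s m)) (?i (s n))"
        using completion_embed_dist s(1) by simp
      also have "\<dots> \<le> ?d (?i (s m)) (X m) + ?d (X m) (?i (s n))"
        using Compl.triangle i_s X by blast
      also have "\<dots> \<le> ?d (?i (s m)) (X m) + (?d (X m) (X n) + ?d (?i (s n)) (X n))"
        using Compl.triangle[OF X i_s X, of m n n] Compl.triangle[OF X X i_s, of m n n]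
          Compl.commute[of "X n" "?i (s n)"] by simp
      also have "\<dots> < e / 3 + (e / 3 + e / 3)"
        using s(2)[of m] s(2)[of n] K L mn by (smt (verit) max.bounded_iff)
      finally show ?thesis by simp
    qed
    then show "\<exists>K. \<forall>m\<ge>K. \<forall>n\<ge>K. N (s m - s n) < e"
      by blast
  qed (use s in auto)
  define Y where "Y = CR `` {s}"
  have Y: "Y \<in> completion D ip"
    using \<open>s \<in> CS\<close> by (simp add: Y_def class_in_completion)
  have "\<exists>K. \<forall>n\<ge>K. X n \<in> completion D ip \<and> ?d (X n) Y < e" if "e > 0" for e
  proof -
    have e: "e / 2 > 0" using that by simp
    obtain K where K: "\<forall>n\<ge>K. 1 / Suc n < e / 2"
      using small[OF e] by blast
    obtain L where L: "\<forall>n\<ge>L. dist (?d (?i (s n)) Y) 0 < e / 2"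
      using metric_LIMSEQ_D[OF completion_embed_tendsto[OF \<open>s \<in> CS\<close>] e] by (auto simp: Y_def)
    have "?d (X n) Y < e" if "n \<ge> max K L" for n
    proof -
      have "?d (X n) Y \<le> ?d (?i (s n)) (X n) + ?d (?i (s n)) Y"
        using Compl.triangle[OF X i_s Y, of n n] Compl.commute[of "X n" "?i (s n)"] by simp
      moreover have "?d (?i (s n)) Y < e / 2"
        using L that by (simp add: dist_real_def)
      moreover have "?d (?i (s n)) (X n) < e / 2"
        using s(2)[of n] K that by (meson max.bounded_iff order_less_trans)
      ultimately show ?thesis by simp
    qed
    then show ?thesis using X by blast
  qed
  with Y show "\<exists>Y. Y \<in> completion D ip \<and> (\<forall>e>0. \<exists>K. \<forall>n\<ge>K. X n \<in> completion D ip \<and> ?d (X n) Y < e)"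
    by blast
qed

end


section \<open>Quasi maximal subspaces and extremal extensions\<close>

definition energy_inner :: "('a::complex_hilbert \<times> 'a) set \<Rightarrow> 'a \<Rightarrow> 'a \<Rightarrow> complex" where
  "energy_inner G f g = cinner (op_app G f) g"

lemma op_app_eq: "linear_operator G \<Longrightarrow> (f, g) \<in> G \<Longrightarrow> op_app G f = g"
  unfolding op_app_def linear_operator_def by (rule the_equality) (auto dest: single_valuedD)

lemma pre_hilbert_energy:
  assumes sa: "self_adjoint G" and pos: "positive_op G"
  shows "pre_hilbert (Domain G) (energy_inner G)"
proof
  have lin: "linear_operator G" and adj: "adjoint_op G = G"
    using sa by (auto simp: self_adjoint_def)
  note app = op_app_eq[OF lin]
  have G: "csubspace G"
    using lin by (simp add: linear_operator_def)
  have add: "(f + g, f' + g') \<in> G" if "(f, f') \<in> G" "(g, g') \<in> G" for f f' g g'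
    using csubspaceD(2)[OF G that] by simp
  have scale: "(c *\<^sub>C f, c *\<^sub>C f') \<in> G" if "(f, f') \<in> G" for c f f'
    using csubspaceD(3)[OF G that, of c] by (simp add: scaleC_prod_def)
  show "csubspace (Domain G)"
    using csubspaceD(1)[OF G] add scale unfolding csubspace_def zero_prod_def by blast
  fix f g h c
  assume f: "f \<in> Domain G"
  then obtain f' where f': "(f, f') \<in> G" by blast
  show "energy_inner G (c *\<^sub>C f) h = c * energy_inner G f h"
    using app[OF f'] app[OF scale[OF f']] by (simp add: energy_inner_def cinner_scaleC_left)
  show "0 < energy_inner G f f" if "f \<noteq> 0"
    using pos f that by (simp add: energy_inner_def positive_op_def)
  assume "g \<in> Domain G"
  then obtain g' where g': "(g, g') \<in> G" by blast
  show "energy_inner G (f + g) h = energy_inner G f h + energy_inner G g h"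
    using app[OF f'] app[OF g'] app[OF add[OF f' g']] by (simp add: energy_inner_def cinner_add_left)
  have "(g, g') \<in> adjoint_op G"
    using g' adj by simp
  then have "cinner f' g = cinner f g'"
    using f' by (auto simp: adjoint_op_def)
  then show "energy_inner G f g = cnj (energy_inner G g f)"
    using app[OF f'] app[OF g'] cinner_commute[of f g'] by (simp add: energy_inner_def)
qed

text \<open>\<open>J G f = G\<inverse> J f\<close> for all \<open>f \<in> D(G)\<close>; membership in the graph of \<open>G\<inverse>\<close> includes that
  \<open>J f\<close> lies in its domain.\<close>

definition J_inverts :: "('a \<Rightarrow> 'a) \<Rightarrow> ('a \<times> 'a) set \<Rightarrow> bool" where
  "J_inverts J G \<longleftrightarrow> (\<forall>(f, g) \<in> G. (J f, J g) \<in> G\<inverse>)"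

definition quasi_maximal :: "('a::complex_hilbert \<Rightarrow> 'a) \<Rightarrow> 'a set \<Rightarrow> 'a set \<Rightarrow> bool" where
  "quasi_maximal J Lp Lm \<longleftrightarrow>
     (\<exists>G. self_adjoint G \<and> positive_op G \<and> G0 J Lp Lm \<subseteq> G \<and> J_inverts J G \<and>
        dense_in_completion (Domain G) (energy_inner G) (Domain (G0 J Lp Lm)))"

text \<open>The infimum is over a nonempty set of nonnegative reals, so it is the genuine one.\<close>

definition extremal_extension ::
    "('a::complex_hilbert \<times> 'a) set \<Rightarrow> ('a \<times> 'a) set \<Rightarrow> bool" where
  "extremal_extension S G \<longleftrightarrow>
     self_adjoint G \<and> nonnegative_op G \<and> S \<subseteq> G \<and>
     (\<forall>\<phi> \<in> Domain G. (INF f \<in> Domain S. Re (cinner (op_app G (\<phi> - f)) (\<phi> - f))) = 0)"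

end

theory Submission
  imports Defs
begin

text \<open>Both sides of the equivalence ask for a self-adjoint extension \<open>G\<close> of \<open>G\<^sub>0\<close> with
  \<open>J G f = G\<inverse> J f\<close>, and the same \<open>G\<close> serves for both.

  For positive \<open>G\<close>, the number \<open>(G (\<phi> - f), \<phi> - f)\<close> is the squared distance from \<open>\<phi>\<close> to \<open>f\<close> in the
  energy space, so extremality says that \<open>D(G\<^sub>0)\<close> approximates every element of \<open>D(G)\<close> in the energy
  norm. As \<open>D(G)\<close> is dense in its completion, this is density of \<open>D(G\<^sub>0)\<close> in the energy space
  (\<open>extremal_iff_dense_in_energy_space\<close>).

  An extremal extension is only required to be nonnegative. A nonnegative self-adjoint operator
  annihilates every \<open>f\<close> with \<open>(G f, f) = 0\<close> (\<open>nonnegative_self_adjoint_null\<close>), and the identity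
  \<open>J G f = G\<inverse> J f\<close> makes \<open>G\<close> injective: \<open>G f = 0\<close> gives \<open>J f = G J 0 = 0\<close>. Hence
  \<open>G\<close> is positive after all (\<open>positive_if_J_inverts\<close>).\<close>

text \<open>Density in the completion can be tested on \<open>D\<close> alone, because the elements of \<open>D\<close> are
  themselves dense and the embedding preserves distances.\<close>

lemma (in pre_hilbert) dense_in_completion_iff:
  assumes "S \<subseteq> D"
  shows "dense_in_completion D ip S \<longleftrightarrow> (\<forall>\<phi>\<in>D. \<forall>e>0. \<exists>f\<in>S. N (\<phi> - f) < e)"
proof -
  let ?d = "completion_dist D ip" and ?i = "completion_embed D ip"
  have i_S: "?i f \<in> completion D ip" if "f \<in> S" for f
    using that assms completion_embed_in by blast
  have dense: "dense_in_completion D ip S \<longleftrightarrow>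
      (\<forall>X\<in>completion D ip. \<forall>e>0. \<exists>f\<in>S. ?d X (?i f) < e)"
    unfolding dense_in_completion_def Compl.metric_closure_of Compl.in_mball
    using i_S by fastforce
  show ?thesis
    unfolding dense
  proof (intro iffI ballI allI impI)
    fix \<phi> e
    assume "\<forall>X\<in>completion D ip. \<forall>e>0. \<exists>f\<in>S. ?d X (?i f) < e"
      and \<phi>: "\<phi> \<in> D" and "0 < (e::real)"
    then obtain f where "f \<in> S" "?d (?i \<phi>) (?i f) < e"
      using completion_embed_in by blast
    then show "\<exists>f\<in>S. N (\<phi> - f) < e"
      using completion_embed_dist \<phi> assms by (metis subsetD)
  next
    fix X e
    assume approx: "\<forall>\<phi>\<in>D. \<forall>e>0. \<exists>f\<in>S. N (\<phi> - f) < e"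
      and X: "X \<in> completion D ip" and "0 < (e::real)"
    then have e: "0 < e / 2" by simp
    obtain \<phi> where \<phi>: "\<phi> \<in> D" "?d (?i \<phi>) X < e / 2"
      using completion_embed_approx[OF X e] .
    obtain f where f: "f \<in> S" "N (\<phi> - f) < e / 2"
      using approx \<phi>(1) e by blast
    have "?d X (?i f) \<le> ?d X (?i \<phi>) + ?d (?i \<phi>) (?i f)"
      using Compl.triangle X completion_embed_in[OF \<phi>(1)] i_S[OF f(1)] .
    also have "\<dots> < e"
      using \<phi> f assms Compl.commute[of X "?i \<phi>"] completion_embed_dist[of \<phi> f] by auto
    finally show "\<exists>f\<in>S. ?d X (?i f) < e"
      using f(1) by blast
  qed
qed

lemma INF_eq_0_iff:
  fixes q :: "'b \<Rightarrow> real"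
  assumes "S \<noteq> {}" and nonneg: "\<And>f. f \<in> S \<Longrightarrow> 0 \<le> q f"
  shows "(INF f\<in>S. q f) = 0 \<longleftrightarrow> (\<forall>e>0. \<exists>f\<in>S. q f < e)"
proof -
  have bdd: "bdd_below (q ` S)"
    using nonneg by (rule bdd_belowI2)
  have "0 \<le> (INF f\<in>S. q f)"
    using assms by (auto intro: cINF_greatest)
  then have "(INF f\<in>S. q f) = 0 \<longleftrightarrow> (\<forall>e>0. (INF f\<in>S. q f) < e)"
    by (metis dual_order.irrefl order_le_less)
  also have "\<dots> \<longleftrightarrow> (\<forall>e>0. \<exists>f\<in>S. q f < e)"
    by (simp add: cINF_less_iff[OF assms(1) bdd])
  finally show ?thesis .
qed

lemma extremal_iff_dense_in_energy_space:
  assumes sa: "self_adjoint G" and pos: "positive_op G" and "S \<subseteq> G" "S \<noteq> {}"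
  shows "extremal_extension S G \<longleftrightarrow>
    dense_in_completion (Domain G) (energy_inner G) (Domain S)"
proof -
  interpret pre_hilbert "Domain G" "energy_inner G"
    using pre_hilbert_energy[OF sa pos] .
  have sub: "Domain S \<subseteq> Domain G" and ne: "Domain S \<noteq> {}"
    using assms by auto
  have nonneg: "nonnegative_op G"
    unfolding nonnegative_op_def
    using ip_self by (auto simp: energy_inner_def less_eq_complex_def simp del: of_real_power)
  have energy: "Re (cinner (op_app G g) g) = (N g)\<^sup>2" if "g \<in> Domain G" for g
    using ip_self[OF that] by (simp add: energy_inner_def)
  have "(INF f\<in>Domain S. Re (cinner (op_app G (\<phi> - f)) (\<phi> - f))) = 0 \<longleftrightarrow>
      (\<forall>e>0. \<exists>f\<in>Domain S. N (\<phi> - f) < e)" if \<phi>: "\<phi> \<in> Domain G" for \<phi>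
  proof -
    have D: "\<phi> - f \<in> Domain G" if "f \<in> Domain S" for f
      using \<phi> sub that by blast
    have "(INF f\<in>Domain S. Re (cinner (op_app G (\<phi> - f)) (\<phi> - f))) =
        (INF f\<in>Domain S. (N (\<phi> - f))\<^sup>2)"
      using energy D by (intro INF_cong) auto
    moreover have "(INF f\<in>Domain S. (N (\<phi> - f))\<^sup>2) = 0 \<longleftrightarrow>
        (\<forall>e>0. \<exists>f\<in>Domain S. (N (\<phi> - f))\<^sup>2 < e)"
      using ne by (intro INF_eq_0_iff) auto
    moreover have "(\<forall>e>0. \<exists>f\<in>Domain S. (N (\<phi> - f))\<^sup>2 < e) \<longleftrightarrow>
        (\<forall>e>0. \<exists>f\<in>Domain S. N (\<phi> - f) < e)"
    proof safe
      fix e :: real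
      assume small: "\<forall>e>0. \<exists>f\<in>Domain S. (N (\<phi> - f))\<^sup>2 < e" and "0 < e"
      then obtain f where "f \<in> Domain S" "(N (\<phi> - f))\<^sup>2 < e\<^sup>2"
        using zero_less_power by blast
      then show "\<exists>f\<in>Domain S. N (\<phi> - f) < e"
        using \<open>0 < e\<close> power2_less_imp_less[of "N (\<phi> - _)" e] by auto
    next
      fix e :: real
      assume small: "\<forall>e>0. \<exists>f\<in>Domain S. N (\<phi> - f) < e" and "0 < e"
      then obtain f where f: "f \<in> Domain S" "N (\<phi> - f) < sqrt e"
        using real_sqrt_gt_zero by blast
      then have "(N (\<phi> - f))\<^sup>2 < (sqrt e)\<^sup>2"
        using N_nonneg[OF D] by (intro power_strict_mono) auto
      then show "\<exists>f\<in>Domain S. (N (\<phi> - f))\<^sup>2 < e"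
        using f(1) \<open>0 < e\<close> by auto
    qed
    ultimately show ?thesis by simp
  qed
  then show ?thesis
    unfolding extremal_extension_def dense_in_completion_iff[OF sub]
    using sa nonneg \<open>S \<subseteq> G\<close> by simp
qed

text \<open>The form \<open>(G f, g)\<close> is positive semidefinite, so \<open>(G f, f) = 0\<close> puts \<open>f\<close> into its radical:
  \<open>G f\<close> is orthogonal to \<open>D(G)\<close>. Orthogonality to \<open>D(G)\<close> means \<open>G f = G\<^sup>* 0 = G 0\<close>, which is \<open>0\<close>.\<close>

lemma nonnegative_self_adjoint_null:
  assumes sa: "self_adjoint G" and nonneg: "nonnegative_op G"
    and f: "(f, f') \<in> G" and null: "cinner f' f = 0"
  shows "f' = 0"
proof -
  have lin: "linear_operator G" and adj: "adjoint_op G = G"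
    using sa by (auto simp: self_adjoint_def)
  have G: "csubspace G" and sv: "single_valued G"
    using lin by (auto simp: linear_operator_def)
  have orth: "cinner f' g = 0" if g: "(g, g') \<in> G" for g g'
  proof -
    define w where "w = cinner f' g"
    have "(f, f') \<in> adjoint_op G"
      using f adj by simp
    then have "cinner g' f = cinner g f'"
      using g by (auto simp: adjoint_op_def)
    then have w': "cinner g' f = cnj w"
      using cinner_commute[of g f'] by (simp add: w_def)
    have expand: "0 \<le> Re (cinner g' g) - 2 * s * (cmod w)\<^sup>2" for s :: real
    proof -
      \<comment> \<open>Perturbing \<open>g\<close> along \<open>f\<close> costs no quadratic term; this multiple of \<open>f\<close> aligns the phases,
        so that the linear term becomes \<open>- 2 s |w|\<^sup>2\<close>.\<close>
      define c where "c = - complex_of_real s * cnj w"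
      have "(g + c *\<^sub>C f, g' + c *\<^sub>C f') \<in> G"
        using csubspaceD(2)[OF G g csubspaceD(3)[OF G f, of c]] by (simp add: scaleC_prod_def)
      then have ge: "0 \<le> cinner (g' + c *\<^sub>C f') (g + c *\<^sub>C f)"
        using nonneg op_app_eq[OF lin] unfolding nonnegative_op_def by (metis DomainI)
      have right: "cinner h (g + c *\<^sub>C f) = cinner h g + cnj c * cinner h f" for h
        using cinner_commute[of h "g + c *\<^sub>C f"] cinner_commute[of h g] cinner_commute[of h f]
        by (simp add: cinner_add_left cinner_scaleC_left)
      have "cinner (g' + c *\<^sub>C f') (g + c *\<^sub>C f) = cinner g' g + (cnj c * cnj w + c * w)"
        by (simp add: cinner_add_left cinner_scaleC_left right null w' flip: w_def)
      also have "cnj c * cnj w + c * w = complex_of_real (- 2 * s * (cmod w)\<^sup>2)"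
        using complex_norm_square[of w] by (simp add: c_def algebra_simps)
      finally show ?thesis
        using ge by (simp add: less_eq_complex_def del: of_real_mult of_real_power)
    qed
    have "w = 0"
    proof (rule ccontr)
      assume "w \<noteq> 0"
      then have "0 \<le> Re (cinner g' g) - (Re (cinner g' g) + 1)"
        using expand[of "(Re (cinner g' g) + 1) / (2 * (cmod w)\<^sup>2)"] by simp
      then show False by simp
    qed
    then show ?thesis by (simp add: w_def)
  qed
  have "cinner g' 0 = cinner g f'" if "(g, g') \<in> G" for g g'
    using orth[OF that] cinner_commute[of g f'] cinner_commute[of g' 0]
      cinner_add_left[of 0 0 g'] by simp
  then have "(0, f') \<in> adjoint_op G"
    by (auto simp: adjoint_op_def)
  moreover have "(0, 0) \<in> G"
    using csubspaceD(1)[OF G] by (simp add: zero_prod_def)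
  ultimately show ?thesis
    using single_valuedD[OF sv] adj by metis
qed

lemma positive_if_J_inverts:
  assumes J: "fundamental_symmetry J" and inv: "J_inverts J G"
    and sa: "self_adjoint G" and nonneg: "nonnegative_op G"
  shows "positive_op G"
  unfolding positive_op_def
proof (intro ballI impI)
  fix f
  assume "f \<in> Domain G" "f \<noteq> 0"
  then obtain f' where f: "(f, f') \<in> G" by blast
  have lin: "linear_operator G"
    using sa by (simp add: self_adjoint_def)
  have J0: "J 0 = 0"
    using fundamental_symmetryD(2)[OF J, of 0 0] by simp
  have "cinner f' f \<noteq> 0"
  proof
    assume "cinner f' f = 0"
    then have "f' = 0"
      using nonnegative_self_adjoint_null[OF sa nonneg f] by simp
    then have "(0, J f) \<in> G"
      using inv f J0 by (fastforce simp: J_inverts_def)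
    moreover have "(0, 0) \<in> G"
      using lin csubspaceD(1)[of G] by (simp add: linear_operator_def zero_prod_def)
    ultimately have "J f = 0"
      using lin by (auto simp: linear_operator_def dest: single_valuedD)
    then show False
      using \<open>f \<noteq> 0\<close> fundamental_symmetryD(4)[OF J, of f] J0 by simp
  qed
  moreover have "0 \<le> cinner (op_app G f) f"
    using nonneg f by (auto simp: nonnegative_op_def)
  ultimately show "0 < cinner (op_app G f) f"
    using op_app_eq[OF lin f] by (simp add: order_less_le)
qed

theorem theorem4p2:
  fixes J :: "'a::complex_hilbert \<Rightarrow> 'a" and Lp Lm :: "'a set"
  assumes "fundamental_symmetry J"
    and "dual_definite J Lp Lm"
    and "closure {f + g | f g. f \<in> Lp \<and> g \<in> Lm} = UNIV"
  shows "quasi_maximal J Lp Lm \<longleftrightarrow>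
    (\<exists>G. extremal_extension (G0 J Lp Lm) G \<and> J_inverts J G)"
proof -
  have "0 \<in> Lp" "0 \<in> Lm"
    using assms(2) by (auto simp: dual_definite_def csubspace_def)
  then have "G0 J Lp Lm \<noteq> {}"
    by (auto simp: G0_eq[OF assms(1,2)])
  note extremal_iff = extremal_iff_dense_in_energy_space[OF _ _ _ this]
  show ?thesis
  proof
    assume "quasi_maximal J Lp Lm"
    then show "\<exists>G. extremal_extension (G0 J Lp Lm) G \<and> J_inverts J G"
      using extremal_iff unfolding quasi_maximal_def by blast
  next
    assume "\<exists>G. extremal_extension (G0 J Lp Lm) G \<and> J_inverts J G"
    then obtain G where ext: "extremal_extension (G0 J Lp Lm) G" and inv: "J_inverts J G"
      by blast
    then have G: "self_adjoint G" "nonnegative_op G" "G0 J Lp Lm \<subseteq> G"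
      by (auto simp: extremal_extension_def)
    have "positive_op G"
      using positive_if_J_inverts[OF assms(1) inv G(1,2)] .
    then show "quasi_maximal J Lp Lm"
      using extremal_iff ext inv G unfolding quasi_maximal_def by blast
  qed
qed

end
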